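(* Let $a\in\{0,1\}$ and let $\bar a$ be the other symbol of $\{0,1\}$. Assume that $\mathbb{S}(\Omega)\cup\mathbb{H}_a(\Omega)\subset\Omega$. If there are positive integers $t,n_1,n_2,\ldots,n_t,m$ and sequences $\gamma,\beta\in M_a\cup\{\eta\}$ with $|\beta|=|\gamma|+2t-1$ such that $$\{a\bar a^{n_1}a\bar a^{n_2}\cdots a\bar a^{n_t}\gamma,\ \bar a^m\beta\}\subset\Omega,$$ then the girth of $\Gamma(\Omega,q)$ is at least $2(|\beta|+4)$.
   Context: Let $q$ be a prime power and $\mathbb{F}_q$ the field with $q$ elements. $\{0,1\}^*$ is the set of finite binary sequences, $\eta$ the null sequence; juxtaposition is concatenation; $|\beta|$ is the length of $\beta$; $\alpha^i$ is the $i$-fold concatenation of $\alpha$ ($\alpha^0=\eta$). $\Omega\subset\{0,1\}^*$ is a finite set satisfying condition C1: $\eta\in\Omega$, and for any $\alpha\in\Omega\setminus\{\eta\}$ the sequence obtained by deleting the last bit of $\alpha$ is in $\Omega$. $L(\Omega)$ and $R(\Omega)$ are two disjoint copies of $\mathbb{F}_q^{|\Omega|+1}$; their vectors are written $[l]$ and $\langle r\rangle$ respectively, with entries indexed by $\Omega\cup\{*\}$, where $*\notin\Omega$ is an extra symbol. $\Gamma(\Omega,q)$ is the bipartite graph with vertex set $L(\Omega)\cup R(\Omega)$ in which $[l]\in L(\Omega)$ and $\langle r\rangle\in R(\Omega)$ are adjacent if and only if $l_\eta+r_\eta=l_*r_*$, $l_{\alpha0}+r_{\alpha0}=r_*l_\alpha$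 for all $\alpha0\in\Omega$, and $l_{\beta1}+r_{\beta1}=l_*r_\beta$ for all $\beta1\in\Omega$ (here $\alpha,\beta\in\{0,1\}^*$). For $\alpha\in\Omega$, $S_\Omega(\alpha)$ is the set of $\beta\in\{0,1\}^*$ with $\{\alpha01\beta,\alpha10\beta\}\cap\Omega\ne\emptyset$, and $\mathbb{S}(\Omega)=\bigcup_{\alpha\in\Omega}S_\Omega(\alpha)$. For $a\in\{0,1\}$, $\mathbb{H}_a(\Omega)$ is the set of all binary sequences obtained from sequences in $\Omega$ by a finite number (possibly zero) of iterated deletions, each of which deletes a symbol $a$ either from the first position (when the first bit is $a$) or from two consecutive $a$'s (replacing some block $aa$ by $a$). $M_0=\{0,01,010,0101,\ldots\}$ and $M_1=\{1,10,101,1010,\ldots\}$ are the sets of nonempty alternating binary sequences with first bit $0$, respectively $1$. *)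

theory Defs
  imports "HOL-Library.Extended_Nat" "HOL-Library.FuncSet" "Graph_Theory.Pair_Digraph"
begin

text \<open>The bit \<open>0\<close> is \<^const>\<open>False\<close> and the bit \<open>1\<close> is \<^const>\<open>True\<close>; the null sequence is \<^term>\<open>[]\<close>.\<close>

type_synonym bits = "bool list"

definition C1 :: "bits set \<Rightarrow> bool" where
  "C1 \<Omega> \<longleftrightarrow> [] \<in> \<Omega> \<and> (\<forall>\<alpha> \<in> \<Omega> - {[]}. butlast \<alpha> \<in> \<Omega>)"

definition S_at :: "bits set \<Rightarrow> bits \<Rightarrow> bits set" where
  "S_at \<Omega> \<alpha> = {\<beta>. {\<alpha> @ [False, True] @ \<beta>, \<alpha> @ [True, False] @ \<beta>} \<inter> \<Omega> \<noteq> {}}"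

definition S_set :: "bits set \<Rightarrow> bits set" where
  "S_set \<Omega> = (\<Union>\<alpha>\<in>\<Omega>. S_at \<Omega> \<alpha>)"

inductive del_step :: "bool \<Rightarrow> bits \<Rightarrow> bits \<Rightarrow> bool" for a :: bool where
  first: "del_step a (a # w) w"
| double: "del_step a (u @ [a, a] @ v) (u @ [a] @ v)"

definition H_set :: "bool \<Rightarrow> bits set \<Rightarrow> bits set" where
  "H_set a \<Omega> = {w. \<exists>v\<in>\<Omega>. (del_step a)\<^sup>*\<^sup>* v w}"

definition M_set :: "bool \<Rightarrow> bits set" where
  "M_set a = {w. w \<noteq> [] \<and> hd w = a \<and> successively (\<noteq>) w}"

text \<open>An undirected graph is represented by its symmetric arc set. The bound \<open>3 \<le> length p\<close>
  excludes walking back and forth along one edge, which \<^const>\<open>pre_digraph.cycle\<close> admits.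
  A graph without cycles has girth \<^term>\<open>\<infinity> :: enat\<close>.\<close>

definition girth :: "'v pair_pre_digraph \<Rightarrow> enat" where
  "girth G = (INF p \<in> {p. pre_digraph.cycle (with_proj G) p \<and> 3 \<le> length p}. enat (length p))"

text \<open>Coordinates are indexed by \<open>\<Omega> \<union> {*}\<close>, with \<^const>\<open>None\<close> for the extra symbol \<open>*\<close>.
  Vectors are extensional functions on this index set, so that there are exactly
  \<open>q\<^bsup>|\<Omega>|+1\<^esup>\<close> of them. Left vertices are tagged by \<^const>\<open>Inl\<close>, right ones by \<^const>\<open>Inr\<close>.\<close>

type_synonym 'f coords = "bits option \<Rightarrow> 'f"

definition coord_space :: "bits set \<Rightarrow> 'f coords set" where
  "coord_space \<Omega> = insert None (Some ` \<Omega>) \<rightarrow>\<^sub>E UNIV"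

definition incident :: "bits set \<Rightarrow> 'f::field coords \<Rightarrow> 'f coords \<Rightarrow> bool" where
  "incident \<Omega> l r \<longleftrightarrow>
     l (Some []) + r (Some []) = l None * r None \<and>
     (\<forall>\<alpha>. \<alpha> @ [False] \<in> \<Omega> \<longrightarrow>
        l (Some (\<alpha> @ [False])) + r (Some (\<alpha> @ [False])) = r None * l (Some \<alpha>)) \<and>
     (\<forall>\<beta>. \<beta> @ [True] \<in> \<Omega> \<longrightarrow>
        l (Some (\<beta> @ [True])) + r (Some (\<beta> @ [True])) = l None * r (Some \<beta>))"

definition Gamma :: "bits set \<Rightarrow> 'f::field itself \<Rightarrow> ('f coords + 'f coords) pair_pre_digraph" where
  "Gamma \<Omega> _ = (let E = {(Inl l, Inr r) | l r.
                      l \<in> coord_space \<Omega> \<and> r \<in> coord_space \<Omega> \<and> incident \<Omega> l r}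
     in \<lparr> pverts = coord_space \<Omega> <+> coord_space \<Omega>, parcs = E \<union> E\<inverse> \<rparr>)"

lemma pair_graph_Gamma:
  assumes "finite \<Omega>"
  shows "pair_graph (Gamma \<Omega> TYPE('f::{field,finite}))"
proof -
  let ?V = "coord_space \<Omega> :: 'f coords set"
  have fin: "finite (?V <+> ?V)"
    using assms by (auto simp: coord_space_def intro!: finite_PiE)
  have sub: "parcs (Gamma \<Omega> TYPE('f)) \<subseteq> (?V <+> ?V) \<times> (?V <+> ?V)"
    by (auto simp: Gamma_def Let_def)
  show ?thesis
  proof
    show "finite (parcs (Gamma \<Omega> TYPE('f)))"
      using finite_subset[OF sub] fin by blast
    show "symmetric (with_proj (Gamma \<Omega> TYPE('f)))"
      by (auto simp: symmetric_def Gamma_def Let_def sym_def)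
  qed (use fin in \<open>auto simp: Gamma_def Let_def\<close>)
qed

end

theory Submission
  imports Defs
begin

text \<open>
  Write \<open>b = length \<beta>\<close> and \<open>a'\<close> for the bit other than \<open>a\<close>. A cycle of the bipartite graph, with
  alternate vertices on the two sides, is a closed walk \<open>v\<^sub>d\<close> of even length \<open>2s\<close>. Let \<open>z\<^sub>d\<close>, the
  colour of \<open>v\<^sub>d\<close>, be its coordinate at the extra symbol. A vertex and a colour determine a
  neighbour, so a walk does not turn back exactly when \<open>z\<^sub>d \<noteq> z\<^sub>d\<^sub>+\<^sub>2\<close>. We must refute \<open>s \<le> b + 3\<close>.

  Normalisation. Closure under \<^const>\<open>S_set\<close> allows changing one coordinate of a vertex and
  compensating along the graph without touching any colour (\<open>linked_adjust\<close>). Closure under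
  \<^const>\<open>H_set\<close> allows adding a constant to all colours on one side, here the side of the even
  indices (\<open>linked_translate\<close>). Hence any prescribed vertex with even index may be assumed to be
  zero, while all colours with odd index stay as they are (\<open>closed_walk_normalise\<close>). The
  hypotheses give no such translation of the odd colours, so some of these may be zero, and the
  argument has to cope with that.

  Growth. On a walk leaving the zero vertex \<open>v\<^sub>0\<close>, a coordinate \<open>w\<close> stays zero as long as \<open>d\<close> is at
  most the number \<open>h\<close> of runs of the word \<open>a'w\<close> (\<open>vanish_low\<close>). The two next values, at \<open>d = h + 1\<close>
  and \<open>d = h + 2\<close>, are products of colours and of differences \<open>z\<^sub>d\<^sub>+\<^sub>2 - z\<^sub>d\<close> (\<open>first_value_snoc\<close>,
  \<open>second_value_snoc\<close>). For \<open>w = a'\<^sup>m\<delta>\<close> with \<open>\<delta>\<close> a prefix of \<open>\<beta>\<close>, the value at \<open>h + 2 = length \<delta> + 3\<close>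
  is a nonzero multiple of a positive power of \<open>z\<^sub>1\<close> (\<open>second_value_iff\<close>). For a word without \<open>aa\<close>, the
  value at \<open>h + 2\<close> is nonzero provided that all odd colours are (\<open>values_nonzero\<close>).

  Collision. Going \<open>d\<close> steps forward or \<open>2s - d\<close> steps backward from \<open>v\<^sub>0\<close> leads to the same vertex.
  If \<open>s \<le> b + 2\<close>, take \<open>\<delta>\<close> of length \<open>s - 2\<close>: at \<open>d = s + 1\<close> the coordinate \<open>a'\<^sup>m\<delta>\<close> vanishes because the
  backward distance \<open>s - 1\<close> is too small, so \<open>z\<^sub>1 = 0\<close>. By symmetry \<open>z\<^sub>-\<^sub>1 = 0\<close>, which contradicts
  \<open>z\<^sub>-\<^sub>1 \<noteq> z\<^sub>1\<close>. If \<open>s = b + 3\<close>, the two values of \<open>a'\<^sup>m\<beta>\<close> at \<open>d = s\<close> agree, so \<open>z\<^sub>1\<close> and \<open>z\<^sub>-\<^sub>1\<close> are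
  both zero or both nonzero; being distinct, they are nonzero. The zero vertex may be put at every
  even index, hence no odd colour is zero. Then the long word, for which \<open>h = b + 2\<close>, is nonzero
  after \<open>s + 1\<close> steps forward and zero after \<open>s - 1\<close> steps backward.
\<close>

section \<open>Counting alternations in a word\<close>

fun alternations :: "bool \<Rightarrow> bits \<Rightarrow> nat" where
  "alternations c [] = 0"
| "alternations c (b # w) = (if b = c then 0 else 1) + alternations b w"

lemma alternations_append:
  "alternations c (u @ w) = alternations c u + alternations (last (c # u)) w"
  by (induction u arbitrary: c) auto

lemma even_alternations: "even (alternations c w) \<longleftrightarrow> last (c # w) = c"
  by (induction w arbitrary: c) auto

lemma alternations_replicate: "alternations c (replicate k c) = 0"
  by (induction k) auto

lemma alternations_alternating:
  "successively (\<noteq>) (c # w) \<Longrightarrow> alternations c w = length w"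
  by (induction w arbitrary: c) auto

lemma M_set_alternating:
  "w \<in> M_set a \<union> {[]} \<Longrightarrow> successively (\<noteq>) ((\<not> a) # w)"
  by (cases w) (auto simp: M_set_def)

lemma alternations_blocks:
  assumes "\<forall>i\<in>set is. n i > 0"
  shows "alternations (\<not> a) (concat (map (\<lambda>i. a # replicate (n i) (\<not> a)) is) @ w)
    = 2 * length is + alternations (\<not> a) w"
  using assms
proof (induction "is")
  case (Cons i "is")
  then obtain k where "n i = Suc k"
    by (auto dest: gr0_implies_Suc)
  then have "alternations a (replicate (n i) (\<not> a) @ u) = Suc (alternations (\<not> a) u)" for u
    by (simp add: alternations_append alternations_replicate)
  with Cons show ?case by simp
qed simp

lemma blocks_no_double:
  assumes "\<forall>i\<in>set is. n i > 0" "successively (\<noteq>) ((\<not> a) # w)"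
  shows "successively (\<lambda>x y. \<not> (x = a \<and> y = a))
    ((\<not> a) # concat (map (\<lambda>i. a # replicate (n i) (\<not> a)) is) @ w)"
  using assms
proof (induction "is")
  case Nil
  then show ?case by (auto elim: successively_mono)
next
  case (Cons i "is")
  have "successively (\<lambda>x y. \<not> (x = a \<and> y = a)) (replicate k (\<not> a) @ (\<not> a) # u)"
    if "successively (\<lambda>x y. \<not> (x = a \<and> y = a)) ((\<not> a) # u)" for k u
    using that by (induction k) (auto simp: successively_Cons hd_append)
  moreover obtain k where "n i = Suc k"
    using Cons.prems by (auto dest: gr0_implies_Suc)
  ultimately show ?case
    using Cons by (force simp: replicate_append_same[symmetric] successively_Cons hd_append)
qed

section \<open>Adjacency with the two sides treated alike\<close>

text \<open>The parameter \<open>c\<close> names the side of \<open>u\<close>: a coordinate ending in \<open>c\<close> is governed by the colour of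
  \<open>u\<close>, one ending in the other bit by the colour of \<open>v\<close>. So the two sides and the two bits are
  interchanged together (\<open>linked_swap\<close>), and one argument serves both values of \<open>a\<close>.\<close>

definition linked :: "bool \<Rightarrow> bits set \<Rightarrow> 'f::field coords \<Rightarrow> 'f coords \<Rightarrow> bool" where
  "linked c \<Omega> u v \<longleftrightarrow>
     u (Some []) + v (Some []) = u None * v None \<and>
     (\<forall>w b. w @ [b] \<in> \<Omega> \<longrightarrow> u (Some (w @ [b])) + v (Some (w @ [b])) =
        (if b = c then u None * v (Some w) else v None * u (Some w)))"

lemma incident_eq_linked: "incident \<Omega> l r \<longleftrightarrow> linked True \<Omega> l r"
  unfolding incident_def linked_def by (auto split: if_splits)

lemma linked_swap: "linked c \<Omega> u v \<longleftrightarrow> linked (\<not> c) \<Omega> v u"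
  unfolding linked_def by (auto simp: add.commute mult.commute)

lemma C1_prefix:
  assumes "C1 \<Omega>" "u @ w \<in> \<Omega>" shows "u \<in> \<Omega>"
  using assms(2)
proof (induction w rule: rev_induct)
  case (snoc b w)
  then have "u @ w @ [b] \<in> \<Omega> - {[]}" by auto
  then have "butlast (u @ w @ [b]) \<in> \<Omega>"
    using assms(1) unfolding C1_def by blast
  then show ?case using snoc.IH by (simp add: butlast_append)
qed simp

text \<open>Each coordinate of a neighbour follows from its colour and a shorter coordinate.\<close>

lemma linked_determines:
  assumes "C1 \<Omega>" "linked c \<Omega> u v" "linked c \<Omega> u v'" "v None = v' None" "w \<in> \<Omega>"
  shows "v (Some w) = v' (Some w)"
  using assms(5)
proof (induction w rule: rev_induct)
  case Nil
  show ?case using assms(2-4) unfolding linked_def by (metis add_left_cancel)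
next
  case (snoc b w)
  then have "v (Some w) = v' (Some w)" using C1_prefix[OF assms(1)] by blast
  then have "u (Some (w @ [b])) + v (Some (w @ [b])) = u (Some (w @ [b])) + v' (Some (w @ [b]))"
    using assms(2-4) snoc.prems unfolding linked_def by simp
  then show ?case by simp
qed

definition side_bit :: "bool \<Rightarrow> int \<Rightarrow> bool" where
  "side_bit a d = (if even d then a else \<not> a)"

text \<open>Vertices are indexed by all integers, periodically, so that any even index can serve as origin
  and reversing is negation of the index. Instead of distinct vertices, only distinct colours two
  steps apart are required: the normalisation preserves them, and they are all that the growth of
  the coordinates depends on.\<close>

definition closed_walk :: "bool \<Rightarrow> bits set \<Rightarrow> nat \<Rightarrow> (int \<Rightarrow> 'f::field coords) \<Rightarrow> bool" where
  "closed_walk a \<Omega> s v \<longleftrightarrow> (\<forall>d. linked (side_bit a d) \<Omega> (v d) (v (d + 1)) \<and>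
     v d None \<noteq> v (d + 2) None \<and> v (d + 2 * int s) = v d)"

lemma closed_walk_map:
  assumes "closed_walk a \<Omega> s v"
    and "\<And>x y. linked a \<Omega> x y \<Longrightarrow> linked a \<Omega> (f x) (g y)"
    and "\<And>x. f x None = x None + c" "\<And>y. g y None = y None"
  shows "closed_walk a \<Omega> s (\<lambda>d. if even d then f (v d) else g (v d))"
  unfolding closed_walk_def
proof (intro allI conjI)
  fix d :: int
  have *: "linked (side_bit a d) \<Omega> (v d) (v (d + 1))"
    using assms(1) unfolding closed_walk_def by blast
  show "linked (side_bit a d) \<Omega> (if even d then f (v d) else g (v d))
          (if even (d + 1) then f (v (d + 1)) else g (v (d + 1)))"
  proof (cases "even d")
    case True
    then show ?thesis using * assms(2) by (simp add: side_bit_def)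
  next
    case False
    then have "linked a \<Omega> (f (v (d + 1))) (g (v d))"
      using * assms(2) by (simp add: side_bit_def linked_swap[of "\<not> a"])
    then show ?thesis using False by (simp add: side_bit_def linked_swap[of "\<not> a"])
  qed
  show "(if even d then f (v d) else g (v d)) None
      \<noteq> (if even (d + 2) then f (v (d + 2)) else g (v (d + 2))) None"
    using assms(1,3,4) unfolding closed_walk_def by simp
  show "(if even (d + 2 * int s) then f (v (d + 2 * int s)) else g (v (d + 2 * int s)))
      = (if even d then f (v d) else g (v d))"
    using assms(1) unfolding closed_walk_def by simp
qed

lemma closed_walk_rotate:
  assumes "closed_walk a \<Omega> s v"
  shows "closed_walk a \<Omega> s (\<lambda>d. v (d + 2 * e))"
  unfolding closed_walk_def
proof
  fix d :: int
  have "side_bit a (d + 2 * e) = side_bit a d" by (simp add: side_bit_def)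
  then show "linked (side_bit a d) \<Omega> (v (d + 2 * e)) (v (d + 1 + 2 * e)) \<and>
     v (d + 2 * e) None \<noteq> v (d + 2 + 2 * e) None \<and> v (d + 2 * int s + 2 * e) = v (d + 2 * e)"
    using assms[unfolded closed_walk_def, rule_format, of "d + 2 * e"] by (simp add: ac_simps)
qed

lemma closed_walk_reverse:
  assumes "closed_walk a \<Omega> s v"
  shows "closed_walk a \<Omega> s (\<lambda>d. v (- d))"
  unfolding closed_walk_def
proof (intro allI conjI)
  fix d :: int
  have "linked (side_bit a (- d - 1)) \<Omega> (v (- d - 1)) (v (- d))"
    using assms[unfolded closed_walk_def, rule_format, of "- d - 1"] by simp
  then show "linked (side_bit a d) \<Omega> (v (- d)) (v (- (d + 1)))"
    by (simp add: linked_swap[of _ _ "v (- d)"] side_bit_def split: if_splits)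
  show "v (- d) None \<noteq> v (- (d + 2)) None"
    using assms[unfolded closed_walk_def, rule_format, of "- d - 2"] by (auto simp: algebra_simps)
  show "v (- (d + 2 * int s)) = v (- d)"
    using assms[unfolded closed_walk_def, rule_format, of "- (d + 2 * int s)"] by simp
qed

section \<open>Correcting a single coordinate\<close>

text \<open>What adding \<open>1\<close> to the coordinate \<open>\<alpha>\<close> of a vertex \<open>u\<close> on side \<open>b\<close>, and subtracting \<open>1\<close> from the
  coordinate \<open>\<alpha>\<close> of all vertices on the other side, forces at the coordinate \<open>\<alpha> @ w\<close> of \<open>u\<close>. The
  change creates a multiple of the colour one letter later and a product of two colours two
  letters later, if these letters differ. That product is the right-hand side of the equation for
  the null sequence, so from there on a copy of \<open>u\<close> itself absorbs it. This copy needs the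
  coordinates of \<open>u\<close> at the words \<open>w\<close> with \<open>\<alpha>01w\<close> or \<open>\<alpha>10w\<close> in \<open>\<Omega>\<close>.\<close>

fun correction :: "bool \<Rightarrow> 'f::field coords \<Rightarrow> bits \<Rightarrow> 'f" where
  "correction b u [] = 1"
| "correction b u [x] = (if x = b then - u None else 0)"
| "correction b u (x # y # w) = (if x = y then 0 else if x = b then - u (Some w) else u (Some w))"

definition adjust :: "bool \<Rightarrow> bits \<Rightarrow> 'f::field \<Rightarrow> 'f coords \<Rightarrow> 'f coords" where
  "adjust b \<alpha> k u = (\<lambda>i. case i of None \<Rightarrow> u None
     | Some w \<Rightarrow> if take (length \<alpha>) w = \<alpha> then u (Some w) + k * correction b u (drop (length \<alpha>) w)
                else u (Some w))"

lemma adjust_None: "adjust b \<alpha> k u None = u None"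
  by (simp add: adjust_def)

lemma adjust_append: "adjust b \<alpha> k u (Some (\<alpha> @ w)) = u (Some (\<alpha> @ w)) + k * correction b u w"
  by (simp add: adjust_def)

lemma adjust_other: "\<nexists>w'. w = \<alpha> @ w' \<Longrightarrow> adjust b \<alpha> k u (Some w) = u (Some w)"
  by (auto simp: adjust_def) (metis append_take_drop_id)

lemma S_set_memI:
  assumes "C1 \<Omega>" "S_set \<Omega> \<subseteq> \<Omega>" "\<alpha> @ x # y # w \<in> \<Omega>" "x \<noteq> y"
  shows "w \<in> \<Omega>"
proof -
  have "\<alpha> \<in> \<Omega>" using C1_prefix assms(1,3) by blast
  moreover have "w \<in> S_at \<Omega> \<alpha>" using assms(3,4) by (cases x) (auto simp: S_at_def)
  ultimately show ?thesis using assms(2) unfolding S_set_def by blast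
qed

text \<open>The corrections on the two sides, taken with opposite signs, satisfy the homogeneous adjacency
  equations.\<close>

lemma linked_correction:
  assumes "C1 \<Omega>" "S_set \<Omega> \<subseteq> \<Omega>" "linked c \<Omega> u v" "\<alpha> @ w @ [b] \<in> \<Omega>"
  shows "correction c u (w @ [b]) - correction (\<not> c) v (w @ [b]) =
    (if b = c then - u None * correction (\<not> c) v w else v None * correction c u w)"
proof -
  have eta: "u (Some []) + v (Some []) = u None * v None"
    and step: "\<And>w b. w @ [b] \<in> \<Omega> \<Longrightarrow> u (Some (w @ [b])) + v (Some (w @ [b])) =
        (if b = c then u None * v (Some w) else v None * u (Some w))"
    using assms(3) unfolding linked_def by auto
  have sum: "correction c u (x # y # r) - correction (\<not> c) v (x # y # r) =
      (if x = c then - 1 else 1) * (u (Some r) + v (Some r))" if "x \<noteq> y" for x y r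
    using that by (cases x; cases y; cases c) simp_all
  show ?thesis
  proof (cases w rule: remdups_adj.cases)
    case 1
    then show ?thesis by (cases b; cases c) simp_all
  next
    case (2 x)
    show ?thesis
    proof (cases "x = b")
      case True
      then show ?thesis using 2 by (cases b; cases c) simp_all
    next
      case False
      then show ?thesis using 2 sum[OF False, of "[]"] unfolding eta
        by (cases b; cases c; cases x) simp_all
    qed
  next
    case (3 x y w')
    show ?thesis
    proof (cases "x = y")
      case False
      then have "w' @ [b] \<in> \<Omega>" using S_set_memI[OF assms(1,2) _ False, of \<alpha>] assms(4) 3 by simp
      note uv = step[OF this]
      have "correction c u (w @ [b]) - correction (\<not> c) v (w @ [b]) =
          (if x = c then - 1 else 1) * (if b = c then u None * v (Some w') else v None * u (Some w'))"
        using sum[OF False, of "w' @ [b]"] 3 unfolding uv by simp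
      then show ?thesis using 3 False by (cases x; cases y; cases b; cases c) simp_all
    qed (simp add: 3)
  qed
qed

lemma linked_adjust:
  assumes "C1 \<Omega>" "S_set \<Omega> \<subseteq> \<Omega>" "linked c \<Omega> u v"
  shows "linked c \<Omega> (adjust c \<alpha> k u) (adjust (\<not> c) \<alpha> (- k) v)"
  unfolding linked_def
proof (intro conjI allI impI)
  have eta: "u (Some []) + v (Some []) = u None * v None"
    and step: "\<And>w b. w @ [b] \<in> \<Omega> \<Longrightarrow> u (Some (w @ [b])) + v (Some (w @ [b])) =
        (if b = c then u None * v (Some w) else v None * u (Some w))"
    using assms(3) unfolding linked_def by auto
  show "adjust c \<alpha> k u (Some []) + adjust (\<not> c) \<alpha> (- k) v (Some []) =
      adjust c \<alpha> k u None * adjust (\<not> c) \<alpha> (- k) v None"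
    using eta by (simp add: adjust_def)
  fix w b assume wb: "w @ [b] \<in> \<Omega>"
  show "adjust c \<alpha> k u (Some (w @ [b])) + adjust (\<not> c) \<alpha> (- k) v (Some (w @ [b])) =
     (if b = c then adjust c \<alpha> k u None * adjust (\<not> c) \<alpha> (- k) v (Some w)
      else adjust (\<not> c) \<alpha> (- k) v None * adjust c \<alpha> k u (Some w))"
  proof (cases "\<exists>w'. w = \<alpha> @ w'")
    case True
    then obtain w' where w: "w = \<alpha> @ w'" by blast
    note delta = linked_correction[OF assms, of \<alpha> w' b]
    have "adjust c \<alpha> k u (Some (w @ [b])) + adjust (\<not> c) \<alpha> (- k) v (Some (w @ [b])) =
        (u (Some (w @ [b])) + v (Some (w @ [b])))
        + k * (correction c u (w' @ [b]) - correction (\<not> c) v (w' @ [b]))"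
      by (simp add: w adjust_append[of _ \<alpha> _ _ "w' @ [b]"] algebra_simps)
    also have "\<dots> = (if b = c then u None * v (Some w) else v None * u (Some w))
        + k * (if b = c then - u None * correction (\<not> c) v w' else v None * correction c u w')"
      using step[OF wb] delta wb w by simp
    also have "\<dots> = (if b = c then u None * (v (Some w) - k * correction (\<not> c) v w')
        else v None * (u (Some w) + k * correction c u w'))"
      by (simp add: algebra_simps)
    finally show ?thesis by (simp add: w adjust_None adjust_append)
  next
    case False
    show ?thesis
    proof (cases "w @ [b] = \<alpha>")
      case True
      then show ?thesis using step[OF wb] False
        adjust_append[of c \<alpha> k u "[]"] adjust_append[of "\<not> c" \<alpha> "- k" v "[]"]
        by (simp add: adjust_None adjust_other)
    next
      case wb': False
      have "\<nexists>w'. w @ [b] = \<alpha> @ w'"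
      proof
        assume "\<exists>w'. w @ [b] = \<alpha> @ w'"
        then obtain w' where "w @ [b] = \<alpha> @ w'" by blast
        then show False using False wb' by (cases w' rule: rev_cases) auto
      qed
      then show ?thesis using step[OF wb] False by (simp add: adjust_None adjust_other)
    qed
  qed
qed

text \<open>Clearing a coordinate disturbs only its proper extensions, so coordinates are cleared in order
  of increasing length.\<close>

lemma closed_walk_clear:
  assumes "C1 \<Omega>" "S_set \<Omega> \<subseteq> \<Omega>" "closed_walk a \<Omega> s v" "finite A"
  shows "\<exists>v'. closed_walk a \<Omega> s v' \<and> (\<forall>d. v' d None = v d None) \<and> (\<forall>w\<in>A. v' 0 (Some w) = 0)"
  using assms(4)
proof (induction A rule: finite_ranking_induct[where f = length])
  case empty
  then show ?case using assms(3) by blast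
next
  case (insert \<alpha> A)
  then obtain v' where v': "closed_walk a \<Omega> s v'" "\<forall>d. v' d None = v d None"
      "\<forall>w\<in>A. v' 0 (Some w) = 0" by blast
  show ?case
  proof (cases "\<alpha> \<in> A")
    case True
    then show ?thesis using v' insert_absorb by metis
  next
    case False
    let ?k = "- v' 0 (Some \<alpha>)"
    let ?v = "\<lambda>d. if even d then adjust a \<alpha> ?k (v' d) else adjust (\<not> a) \<alpha> (- ?k) (v' d)"
    have "closed_walk a \<Omega> s ?v"
    proof (rule closed_walk_map[OF v'(1), where c = 0])
      show "linked a \<Omega> (adjust a \<alpha> ?k x) (adjust (\<not> a) \<alpha> (- ?k) y)" if "linked a \<Omega> x y" for x y
        using linked_adjust[OF assms(1,2) that] .
    qed (simp_all add: adjust_None)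
    moreover have "\<forall>d. ?v d None = v d None" using v'(2) by (simp add: adjust_None)
    moreover have "?v 0 (Some w) = 0" if "w \<in> insert \<alpha> A" for w
    proof (cases "w = \<alpha>")
      case True
      then show ?thesis using adjust_append[of a \<alpha> ?k "v' 0" "[]"] by simp
    next
      case w: False
      then have "length w \<le> length \<alpha>" using that insert by auto
      then have "\<nexists>w'. w = \<alpha> @ w'" using w by auto
      then have "?v 0 (Some w) = v' 0 (Some w)"
        using adjust_other[of w \<alpha> a ?k "v' 0"] by simp
      then show ?thesis using v'(3) that w by simp
    qed
    ultimately show ?thesis by (intro exI[of _ ?v] conjI ballI)
  qed
qed

section \<open>Translating the first coordinate on one side\<close>

text \<open>The extra symbol \<^const>\<open>None\<close> behaves like a word that becomes the null sequence when a letter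
  is appended: the equation for the null sequence is the equation for that letter.\<close>

fun extend :: "bool \<Rightarrow> bits option \<Rightarrow> bits option" where
  "extend b None = Some []"
| "extend b (Some w) = Some (w @ [b])"

definition combine :: "('i \<Rightarrow> 'f::field) \<Rightarrow> ('f \<times> 'i) list \<Rightarrow> 'f" where
  "combine f T = (\<Sum>(k, i)\<leftarrow>T. k * f i)"

lemma combine_append: "combine f (T @ T') = combine f T + combine f T'"
  by (simp add: combine_def)

lemma combine_map_index: "combine f (map (apsnd g) T) = combine (f \<circ> g) T"
  by (induction T) (auto simp: combine_def)

lemma combine_scale: "combine f (map (apfst ((*) k)) T) = k * combine f T"
  by (induction T) (auto simp: combine_def algebra_simps)

lemma combine_linear:
  assumes "\<And>i. i \<in> snd ` set T \<Longrightarrow> f i + g i = k * h i"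
  shows "combine f T + combine g T = k * combine h T"
  using assms
proof (induction T)
  case (Cons x T)
  have "snd x \<in> snd ` set (x # T)" by simp
  then have "fst x * (f (snd x) + g (snd x)) = fst x * (k * h (snd x))"
    using Cons.prems by simp
  moreover have "combine f T + combine g T = k * combine h T"
    using Cons by simp
  ultimately show ?case
    by (auto simp: combine_def case_prod_unfold algebra_simps)
qed (simp add: combine_def)

text \<open>Formal linear combinations that give the coordinate \<open>rev w\<close> after all colours of one side grew by
  \<open>k\<close>, for vertices on the shifted side and on the other side. The recursion is solving the
  adjacency equations letter by letter: at a letter \<open>a\<close> the shifted colour multiplies a coordinate
  of the unshifted side, and the surplus \<open>k\<close> times that coordinate is assigned to the unshifted
  side. A run of letters \<open>a\<close> thus yields a binomial expansion over shorter runs.\<close>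

fun shifted_terms unshifted_terms :: "bool \<Rightarrow> 'f::field \<Rightarrow> bits \<Rightarrow> ('f \<times> bits option) list" where
  "shifted_terms a k [] = [(1, Some [])]"
| "unshifted_terms a k [] = [(1, Some []), (k, None)]"
| "shifted_terms a k (b # w) =
    map (apsnd (extend b)) (if b = a then unshifted_terms a k w else shifted_terms a k w)"
| "unshifted_terms a k (b # w) = (if b = a
    then map (apsnd (extend b)) (unshifted_terms a k w) @ map (apfst ((*) k)) (unshifted_terms a k w)
    else map (apsnd (extend b)) (shifted_terms a k w))"

text \<open>The surplus terms drop a letter \<open>a\<close>. A run inside a word keeps at least one \<open>a\<close> as soon as another
  letter follows, while a leading run may vanish: exactly the deletions of \<^const>\<open>del_step\<close>. On the
  unshifted side the last run may lose all its letters, which is why that half speaks of the word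
  extended by \<open>a\<close>, and why the arbitrary tail \<open>z\<close> is carried through the induction.\<close>

lemma terms_reducible:
  fixes k :: "'f::field"
  shows "(i \<in> snd ` set (shifted_terms a k w) \<longrightarrow>
      (\<exists>u. i = Some u \<and> (\<forall>z. (del_step a)\<^sup>*\<^sup>* (rev w @ z) (u @ z)))) \<and>
    (i \<in> snd ` set (unshifted_terms a k w) \<longrightarrow>
      (\<exists>u. extend a i = Some u \<and> (\<forall>z. (del_step a)\<^sup>*\<^sup>* (rev w @ a # z) (u @ z))))"
proof (induction w arbitrary: i)
  case Nil
  show ?case by (auto simp: del_step.first r_into_rtranclp)
next
  case (Cons b w)
  have Q: "\<exists>u. i = Some u \<and> (\<forall>z. (del_step a)\<^sup>*\<^sup>* (rev w @ z) (u @ z))"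
    if "i \<in> snd ` set (shifted_terms a k w)" for i using Cons that by blast
  have P: "\<exists>u. extend a i = Some u \<and> (\<forall>z. (del_step a)\<^sup>*\<^sup>* (rev w @ a # z) (u @ z))"
    if "i \<in> snd ` set (unshifted_terms a k w)" for i using Cons that by blast
  have double: "del_step a (rev w @ a # a # z) (rev w @ a # z)" for z
    using del_step.double[of a "rev w" z] by simp
  have shifted: "\<exists>u. i = Some u \<and> (\<forall>z. (del_step a)\<^sup>*\<^sup>* (rev (b # w) @ z) (u @ z))"
    if i: "i \<in> snd ` set (shifted_terms a k (b # w))" for i
  proof (cases "b = a")
    case True
    then obtain j where "j \<in> snd ` set (unshifted_terms a k w)" "i = extend a j"
      using i by (auto simp: image_iff)
    then show ?thesis using P True by fastforce
  next
    case False
    then obtain j where "j \<in> snd ` set (shifted_terms a k w)" "i = extend b j"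
      using i by (auto simp: image_iff)
    with Q obtain u where "i = Some (u @ [b])" "\<forall>z. (del_step a)\<^sup>*\<^sup>* (rev w @ z) (u @ z)"
      by fastforce
    then show ?thesis by (intro exI[of _ "u @ [b]"]) simp
  qed
  have "\<exists>u. extend a i = Some u \<and> (\<forall>z. (del_step a)\<^sup>*\<^sup>* (rev (b # w) @ a # z) (u @ z))"
    if i: "i \<in> snd ` set (unshifted_terms a k (b # w))"
  proof (cases "i \<in> snd ` set (shifted_terms a k (b # w))")
    case True
    then obtain u where "i = Some u" "\<forall>z. (del_step a)\<^sup>*\<^sup>* (rev (b # w) @ z) (u @ z)"
      using shifted by blast
    then show ?thesis by (intro exI[of _ "u @ [a]"]) simp
  next
    case False
    then have b: "b = a"
      using i by (auto split: if_splits)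
    with False i have "i \<in> snd ` set (map (apfst ((*) k)) (unshifted_terms a k w))"
      by auto
    then have "i \<in> snd ` set (unshifted_terms a k w)"
      by (force simp: image_iff)
    with P obtain u where u: "extend a i = Some u" "\<forall>z. (del_step a)\<^sup>*\<^sup>* (rev w @ a # z) (u @ z)"
      by blast
    then have "(del_step a)\<^sup>*\<^sup>* (rev w @ a # a # z) (u @ z)" for z
      by (blast intro: converse_rtranclp_into_rtranclp double)
    then show ?thesis using u b by auto
  qed
  with shifted show ?case by blast
qed

definition translate_shifted :: "bool \<Rightarrow> 'f::field \<Rightarrow> 'f coords \<Rightarrow> 'f coords" where
  "translate_shifted a k u = (\<lambda>i. case i of None \<Rightarrow> u None + k
     | Some w \<Rightarrow> combine u (shifted_terms a k (rev w)))"

definition translate_unshifted :: "bool \<Rightarrow> 'f::field \<Rightarrow> 'f coords \<Rightarrow> 'f coords" where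
  "translate_unshifted a k u = (\<lambda>i. case i of None \<Rightarrow> u None
     | Some w \<Rightarrow> combine u (unshifted_terms a k (rev w)))"

text \<open>By \<open>terms_reducible\<close> and closure under deletions, every term of the combinations comes with its
  own adjacency equation; these equations are added up.\<close>

lemma linked_translate:
  assumes H: "H_set a \<Omega> \<subseteq> \<Omega>" and lk: "linked a \<Omega> u v"
  shows "linked a \<Omega> (translate_shifted a k u) (translate_unshifted a k v)"
  unfolding linked_def
proof (intro conjI allI impI)
  have eta: "u (Some []) + v (Some []) = u None * v None"
    and step: "\<And>w b. w @ [b] \<in> \<Omega> \<Longrightarrow> u (Some (w @ [b])) + v (Some (w @ [b])) =
        (if b = a then u None * v (Some w) else v None * u (Some w))"
    using lk unfolding linked_def by auto
  have red: "w' \<in> \<Omega>" if "(del_step a)\<^sup>*\<^sup>* w w'" "w \<in> \<Omega>" for w w'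
    using H that unfolding H_set_def by blast
  show "translate_shifted a k u (Some []) + translate_unshifted a k v (Some []) =
      translate_shifted a k u None * translate_unshifted a k v None"
    using eta by (simp add: translate_shifted_def translate_unshifted_def combine_def algebra_simps)
  fix w b assume wb: "w @ [b] \<in> \<Omega>"
  show "translate_shifted a k u (Some (w @ [b])) + translate_unshifted a k v (Some (w @ [b])) =
     (if b = a then translate_shifted a k u None * translate_unshifted a k v (Some w)
      else translate_unshifted a k v None * translate_shifted a k u (Some w))"
  proof (cases "b = a")
    case True
    have "combine (u \<circ> extend a) (unshifted_terms a k (rev w))
        + combine (v \<circ> extend a) (unshifted_terms a k (rev w))
      = u None * combine v (unshifted_terms a k (rev w))"
    proof (rule combine_linear)
      fix i assume "i \<in> snd ` set (unshifted_terms a k (rev w))"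
      then obtain x where x: "extend a i = Some x" "\<forall>z. (del_step a)\<^sup>*\<^sup>* (w @ a # z) (x @ z)"
        using terms_reducible[of i a k "rev w"] by auto
      then have "(del_step a)\<^sup>*\<^sup>* (w @ [a]) x"
        using x(2)[rule_format, of "[]"] by simp
      then have "x \<in> \<Omega>" using red wb True by blast
      then show "(u \<circ> extend a) i + (v \<circ> extend a) i = u None * v i"
        using x(1) eta step[of _ a] by (cases i) auto
    qed
    then show ?thesis using True
      by (simp add: translate_shifted_def translate_unshifted_def combine_append
          combine_map_index combine_scale algebra_simps)
  next
    case False
    have "combine (u \<circ> extend b) (shifted_terms a k (rev w))
        + combine (v \<circ> extend b) (shifted_terms a k (rev w))
      = v None * combine u (shifted_terms a k (rev w))"
    proof (rule combine_linear)
      fix i assume "i \<in> snd ` set (shifted_terms a k (rev w))"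
      then obtain x where x: "i = Some x" "\<forall>z. (del_step a)\<^sup>*\<^sup>* (w @ z) (x @ z)"
        using terms_reducible[of i a k "rev w"] by auto
      then have "x @ [b] \<in> \<Omega>" using red wb by blast
      then show "(u \<circ> extend b) i + (v \<circ> extend b) i = v None * u i"
        using x(1) step[of x b] False by simp
    qed
    then show ?thesis using False
      by (simp add: translate_shifted_def translate_unshifted_def combine_map_index)
  qed
qed

text \<open>The translation makes the colour of the vertex at index \<open>0\<close> zero; clearing afterwards leaves
  colours alone.\<close>

lemma closed_walk_normalise:
  assumes "finite \<Omega>" "C1 \<Omega>" "S_set \<Omega> \<union> H_set a \<Omega> \<subseteq> \<Omega>" "closed_walk a \<Omega> s v"
  obtains v' where "closed_walk a \<Omega> s v'" "\<And>d. odd d \<Longrightarrow> v' d None = v d None"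
    "v' 0 None = 0" "\<And>w. w \<in> \<Omega> \<Longrightarrow> v' 0 (Some w) = 0"
proof -
  let ?k = "- v 0 None"
  let ?v = "\<lambda>d. if even d then translate_shifted a ?k (v d) else translate_unshifted a ?k (v d)"
  have "closed_walk a \<Omega> s ?v"
  proof (rule closed_walk_map[OF assms(4), where c = ?k])
    show "linked a \<Omega> (translate_shifted a ?k x) (translate_unshifted a ?k y)"
      if "linked a \<Omega> x y" for x y
      using linked_translate that assms(3) by blast
  qed (simp_all add: translate_shifted_def translate_unshifted_def)
  from closed_walk_clear[OF assms(2) _ this assms(1)] assms(3)
  obtain v' where "closed_walk a \<Omega> s v'" "\<forall>d. v' d None = ?v d None"
      "\<forall>w\<in>\<Omega>. v' 0 (Some w) = 0"
    by auto
  then show ?thesis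
    by (intro that[of v']) (simp_all add: translate_shifted_def translate_unshifted_def)
qed

section \<open>Walks leaving the zero vertex\<close>

lemma eliminate_middle:
  fixes x y z :: "'f::field"
  assumes "x + y = p" "y + z = q" "r = q - p"
  shows "z = x + r"
  unfolding assms(3) assms(1,2)[symmetric] by simp

locale walk_from_zero =
  fixes a :: bool and \<Omega> :: "bits set" and v :: "nat \<Rightarrow> 'f::field coords"
  assumes C1: "C1 \<Omega>"
    and link: "\<And>d. linked (side_bit a (int d)) \<Omega> (v d) (v (d + 1))"
    and turn: "\<And>d. v d None \<noteq> v (d + 2) None"
    and zero_None: "v 0 None = 0"
    and zero_Some: "\<And>w. w \<in> \<Omega> \<Longrightarrow> v 0 (Some w) = 0"
begin

text \<open>The number of runs of \<open>w\<close> with \<open>\<not> a\<close> put in front. For \<open>w \<noteq> []\<close> its parity tells the last letter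
  of \<open>w\<close>, which matches the parity that decides between \<open>two_steps_same\<close> and \<open>two_steps_other\<close>.\<close>

abbreviation height :: "bits \<Rightarrow> nat" where
  "height w \<equiv> Suc (alternations (\<not> a) w)"

lemma Nil_mem: "[] \<in> \<Omega>"
  using C1 by (simp add: C1_def)

lemma prefix_mem: "u @ w \<in> \<Omega> \<Longrightarrow> u \<in> \<Omega>"
  using C1_prefix[OF C1] .

lemma link_Nil: "v d (Some []) + v (Suc d) (Some []) = v d None * v (Suc d) None"
  using link[of d] unfolding linked_def by simp

lemma link_snoc:
  "w @ [b] \<in> \<Omega> \<Longrightarrow> v d (Some (w @ [b])) + v (Suc d) (Some (w @ [b])) =
     (if b = side_bit a (int d) then v d None * v (Suc d) (Some w)
      else v (Suc d) None * v d (Some w))"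
  using link[of d] unfolding linked_def by simp

text \<open>Subtracting the equations of two consecutive edges eliminates the middle vertex at the coordinate
  in question.\<close>

lemma two_steps_same:
  assumes "w @ [b] \<in> \<Omega>" "b = side_bit a (int d)"
  shows "v (d + 2) (Some (w @ [b])) = v d (Some (w @ [b]))
    + (v (d + 2) None - v d None) * v (d + 1) (Some w)"
proof (rule eliminate_middle)
  show "v d (Some (w @ [b])) + v (d + 1) (Some (w @ [b])) = v d None * v (d + 1) (Some w)"
    using link_snoc[OF assms(1), of d] assms(2) by simp
  show "v (d + 1) (Some (w @ [b])) + v (d + 2) (Some (w @ [b])) = v (d + 2) None * v (d + 1) (Some w)"
    using link_snoc[OF assms(1), of "Suc d"] assms(2) by (simp add: side_bit_def)
qed (simp add: algebra_simps)

lemma two_steps_other: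
  assumes "w @ [b] \<in> \<Omega>" "b \<noteq> side_bit a (int d)"
  shows "v (d + 2) (Some (w @ [b])) = v d (Some (w @ [b]))
    + v (d + 1) None * (v (d + 2) (Some w) - v d (Some w))"
proof (rule eliminate_middle)
  show "v d (Some (w @ [b])) + v (d + 1) (Some (w @ [b])) = v (d + 1) None * v d (Some w)"
    using link_snoc[OF assms(1), of d] assms(2) by simp
  show "v (d + 1) (Some (w @ [b])) + v (d + 2) (Some (w @ [b])) = v (d + 1) None * v (d + 2) (Some w)"
    using link_snoc[OF assms(1), of "Suc d"] assms(2) by (simp add: side_bit_def split: if_splits)
qed (simp add: algebra_simps)

lemma height_snoc:
  "height (w @ [b]) = (if last ((\<not> a) # w) = b then height w else Suc (height w))"
  by (simp add: alternations_append)

lemma side_bit_height: "side_bit a (int (height (w @ [b]))) = b"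
proof -
  have "even (alternations (\<not> a) (w @ [b])) \<longleftrightarrow> b = (\<not> a)"
    by (subst even_alternations) simp
  then show ?thesis by (auto simp: side_bit_def)
qed

text \<open>A letter raises the height by at most one. If it starts a new run, its coordinate could become nonzero
  one step early only through \<open>two_steps_other\<close>, which the parity of the height excludes.\<close>

lemma vanish_low:
  assumes "w \<in> \<Omega>" "d \<le> height w"
  shows "v d (Some w) = 0"
  using assms
proof (induction w arbitrary: d rule: rev_induct)
  case Nil
  then consider "d = 0" | "d = 1" by force
  then show ?case using zero_Some[OF Nil_mem] link_Nil[of 0] zero_None by cases auto
next
  case (snoc b w)
  have w: "w \<in> \<Omega>" using snoc.prems(1) prefix_mem by blast
  from snoc.prems(2) show ?case
  proof (induction d rule: induct_nat_012)
    case 0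
    then show ?case using zero_Some snoc.prems(1) by simp
  next
    case 1
    have "v 0 (Some (w @ [b])) + v 1 (Some (w @ [b])) = 0"
      using link_snoc[OF snoc.prems(1), of 0] zero_None zero_Some[OF w] by simp
    then show ?case using zero_Some[OF snoc.prems(1)] by simp
  next
    case (ge2 d)
    have low: "v d (Some (w @ [b])) = 0" using ge2 by simp
    show ?case
    proof (cases "b = side_bit a (int d)")
      case True
      have "v (d + 1) (Some w) = 0"
        using snoc.IH[OF w, of "d + 1"] ge2(3) unfolding height_snoc by (simp split: if_splits)
      then show ?thesis using two_steps_same[OF snoc.prems(1) True] low by simp
    next
      case False
      have "Suc (Suc d) \<noteq> height (w @ [b])"
        using side_bit_height[of w b] False by (metis even_Suc_Suc_iff even_of_nat side_bit_def)
      then have "Suc (Suc d) \<le> height w"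
        using ge2(3) unfolding height_snoc by (simp split: if_splits)
      then have "v (d + 2) (Some w) = 0" "v d (Some w) = 0"
        using snoc.IH[OF w] by simp_all
      then show ?thesis using two_steps_other[OF snoc.prems(1) False] low by simp
    qed
  qed
qed

text \<open>Here \<open>height (w @ [b]) + 1\<close> is \<open>height w + 1\<close> when \<open>b\<close> prolongs the last run, and \<open>height w + 2\<close>
  when it starts a new one. The first two values that can be nonzero therefore obey a closed
  recursion, given by this lemma and the next.\<close>

lemma first_value_snoc:
  assumes "w @ [b] \<in> \<Omega>"
  shows "v (height (w @ [b]) + 1) (Some (w @ [b]))
    = v (height (w @ [b])) None * v (height (w @ [b]) + 1) (Some w)"
proof -
  let ?d = "alternations (\<not> a) (w @ [b])"
  have w: "w \<in> \<Omega>" using assms prefix_mem by blast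
  have "b \<noteq> side_bit a (int ?d)"
    using side_bit_height[of w b] by (auto simp: side_bit_def split: if_splits)
  moreover have "v ?d (Some (w @ [b])) = 0" using vanish_low[OF assms] by simp
  moreover have "v ?d (Some w) = 0"
    using vanish_low[OF w, of ?d] by (simp add: alternations_append)
  ultimately show ?thesis using two_steps_other[OF assms, of ?d] by simp
qed

lemma second_value_snoc:
  assumes "w @ [b] \<in> \<Omega>"
  shows "v (height (w @ [b]) + 2) (Some (w @ [b]))
    = (v (height (w @ [b]) + 2) None - v (height (w @ [b])) None) * v (height (w @ [b]) + 1) (Some w)"
  using two_steps_same[OF assms side_bit_height[symmetric]] vanish_low[OF assms order_refl] by simp

lemma second_colour_nonzero: "v 2 None \<noteq> 0"
  using turn[of 0] zero_None by (simp add: numeral_2_eq_2)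

lemma first_value_Nil: "v 2 (Some []) = v 1 None * v 2 None"
  using link_Nil[of 1] vanish_low[OF Nil_mem, of 1] by (simp add: numeral_2_eq_2)

lemma second_value_Nil: "v 3 (Some []) = v 2 None * (v 3 None - v 1 None)"
  using link_Nil[of 2] first_value_Nil by (simp add: numeral_3_eq_3 numeral_2_eq_2 algebra_simps)

lemma second_value_Nil_nonzero: "v 3 (Some []) \<noteq> 0"
  using second_value_Nil second_colour_nonzero turn[of 1] by (simp add: numeral_3_eq_3)

lemma first_value_replicate:
  "replicate k (\<not> a) \<in> \<Omega> \<Longrightarrow> v 2 (Some (replicate k (\<not> a))) = v 1 None ^ Suc k * v 2 None"
proof (induction k)
  case 0
  then show ?case using first_value_Nil by simp
next
  case (Suc k)
  then have mem: "replicate k (\<not> a) @ [\<not> a] \<in> \<Omega>"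
    by (simp add: replicate_append_same)
  then have IH: "v 2 (Some (replicate k (\<not> a))) = v 1 None ^ Suc k * v 2 None"
    using Suc.IH prefix_mem by blast
  have "height (replicate k (\<not> a) @ [\<not> a]) = 1"
    unfolding replicate_append_same replicate_Suc[symmetric] by (simp only: alternations_replicate One_nat_def)
  then show ?case using first_value_snoc[OF mem] IH
    by (simp add: replicate_append_same numeral_2_eq_2)
qed

text \<open>The initial run contributes powers of the colour \<open>z\<^sub>1\<close>. From then on every letter starts a new
  run, so only \<open>second_value_snoc\<close> along new runs is used, whose factors are differences of colours
  two steps apart.\<close>

lemma second_value_iff:
  assumes "replicate m (\<not> a) @ w \<in> \<Omega>" "m > 0" "successively (\<noteq>) ((\<not> a) # w)"
  shows "v (length w + 3) (Some (replicate m (\<not> a) @ w)) = 0 \<longleftrightarrow> v 1 None = 0"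
  using assms(1,3)
proof (induction w rule: rev_induct)
  case Nil
  obtain k where m: "m = Suc k" using assms(2) gr0_implies_Suc by blast
  have mem: "replicate k (\<not> a) @ [\<not> a] \<in> \<Omega>"
    using Nil m by (simp add: replicate_append_same)
  have "height (replicate k (\<not> a) @ [\<not> a]) = 1"
    unfolding replicate_append_same replicate_Suc[symmetric] by (simp only: alternations_replicate One_nat_def)
  then have "v 3 (Some (replicate m (\<not> a))) = (v 3 None - v 1 None) * v 2 (Some (replicate k (\<not> a)))"
    using second_value_snoc[OF mem]
    by (simp add: replicate_append_same m numeral_3_eq_3 numeral_2_eq_2)
  then show ?case
    using first_value_replicate[OF prefix_mem[OF mem]] turn[of 1] second_colour_nonzero
    by (auto simp: numeral_3_eq_3)
next
  case (snoc b w)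
  let ?w = "replicate m (\<not> a) @ w"
  have mem: "?w @ [b] \<in> \<Omega>" using snoc.prems by simp
  have alt: "successively (\<noteq>) ((\<not> a) # w)"
    using snoc.prems(2) successively_append_iff[of "(\<noteq>)" "(\<not> a) # w" "[b]"] by simp
  have IH: "v (length w + 3) (Some ?w) = 0 \<longleftrightarrow> v 1 None = 0"
    using snoc.IH[OF prefix_mem[OF mem] alt] .
  have "height (?w @ [b]) = length w + 2"
    using alternations_alternating[OF snoc.prems(2)] assms(2)
    by (simp add: alternations_append alternations_replicate del: alternations.simps)
  then show ?case using second_value_snoc[OF mem] turn[of "length w + 2"] IH
    by (simp add: eval_nat_numeral)
qed

text \<open>Without \<open>aa\<close>, only runs of \<open>\<not> a\<close> are prolonged. Their heights are odd, so the colours that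
  \<open>first_value_snoc\<close> brings in all have odd index. Nonvanishing of the first value is needed, and
  carried along, only for words that end in \<open>\<not> a\<close>.\<close>

lemma values_nonzero:
  assumes "\<And>d. odd d \<Longrightarrow> v d None \<noteq> 0" "w \<in> \<Omega>"
    and "successively (\<lambda>x y. \<not> (x = a \<and> y = a)) ((\<not> a) # w)"
  shows "v (height w + 2) (Some w) \<noteq> 0 \<and>
    (last ((\<not> a) # w) = (\<not> a) \<longrightarrow> v (height w + 1) (Some w) \<noteq> 0)"
  using assms(2,3)
proof (induction w rule: rev_induct)
  case Nil
  show ?case
    using first_value_Nil second_value_Nil_nonzero second_colour_nonzero assms(1)[of 1]
    by (simp add: numeral_3_eq_3 numeral_2_eq_2)
next
  case (snoc b w)
  let ?h = "height (w @ [b])"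
  have sc: "successively (\<lambda>x y. \<not> (x = a \<and> y = a)) ((\<not> a) # w)"
    and ab: "\<not> (last ((\<not> a) # w) = a \<and> b = a)"
    using snoc.prems(2) successively_append_iff[of "\<lambda>x y. \<not> (x = a \<and> y = a)" "(\<not> a) # w" "[b]"]
    by simp_all
  have IH: "v (height w + 2) (Some w) \<noteq> 0"
      "last ((\<not> a) # w) = (\<not> a) \<Longrightarrow> v (height w + 1) (Some w) \<noteq> 0"
    using snoc.IH[OF prefix_mem[OF snoc.prems(1)] sc] by blast+
  have nz: "v (?h + 1) (Some w) \<noteq> 0"
  proof (cases "last ((\<not> a) # w) = b")
    case True
    then show ?thesis using IH(2) ab unfolding height_snoc by auto
  next
    case False
    then show ?thesis using IH(1) unfolding height_snoc by simp
  qed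
  have "v ?h None \<noteq> 0" if "b = (\<not> a)"
  proof (rule assms(1))
    show "odd ?h" using side_bit_height[of w b] that by (auto simp: side_bit_def split: if_splits)
  qed
  then show ?case
    using first_value_snoc[OF snoc.prems(1)] second_value_snoc[OF snoc.prems(1)] nz turn[of ?h]
    by auto
qed

end

section \<open>Short closed walks\<close>

lemma closed_walk_from_zero:
  assumes "C1 \<Omega>" "closed_walk a \<Omega> s v" "v 0 None = 0" "\<And>w. w \<in> \<Omega> \<Longrightarrow> v 0 (Some w) = 0"
  shows "walk_from_zero a \<Omega> (\<lambda>d. v (int d))"
proof
  fix d :: nat
  show "linked (side_bit a (int d)) \<Omega> (v (int d)) (v (int (d + 1)))"
    and "v (int d) None \<noteq> v (int (d + 2)) None"
    using assms(2)[unfolded closed_walk_def, rule_format, of "int d"] by (simp_all add: add.commute)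
qed (use assms in auto)

lemma closed_walk_ends:
  assumes "closed_walk a \<Omega> s v" "d + e = 2 * s"
  shows "v (int d) = v (- int e)"
proof -
  have "int d = - int e + 2 * int s" using assms(2) by linarith
  then show ?thesis
    using assms(1)[unfolded closed_walk_def, rule_format, of "- int e"] by simp
qed

text \<open>The collision of forward and backward walks. The origin is arbitrary among the even indices; this
  is used to see that all odd colours are nonzero when \<open>s = length \<beta> + 3\<close>.\<close>

lemma closed_walk_long:
  fixes v :: "int \<Rightarrow> 'f::field coords"
  assumes fin: "finite \<Omega>" and C1: "C1 \<Omega>" and cl: "S_set \<Omega> \<union> H_set a \<Omega> \<subseteq> \<Omega>"
    and walk: "closed_walk a \<Omega> s v" and s: "s \<ge> 2"
    and m: "m > 0" and \<beta>: "successively (\<noteq>) ((\<not> a) # \<beta>)" and mem: "replicate m (\<not> a) @ \<beta> \<in> \<Omega>"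
    and w: "w \<in> \<Omega>" "successively (\<lambda>x y. \<not> (x = a \<and> y = a)) ((\<not> a) # w)"
      "alternations (\<not> a) w = length \<beta> + 1"
  shows "s \<ge> length \<beta> + 4"
proof (rule ccontr)
  assume "\<not> s \<ge> length \<beta> + 4"
  then have short: "s \<le> length \<beta> + 3" by simp
  have both: "s = length \<beta> + 3 \<and> v 1 None \<noteq> 0 \<and> v (- 1) None \<noteq> 0"
    if walk: "closed_walk a \<Omega> s v" for v :: "int \<Rightarrow> 'f coords"
  proof -
    obtain v' where v': "closed_walk a \<Omega> s v'" "\<And>d. odd d \<Longrightarrow> v' d None = v d None"
      "v' 0 None = 0" "\<And>w. w \<in> \<Omega> \<Longrightarrow> v' 0 (Some w) = 0"
      using closed_walk_normalise[OF fin C1 cl walk] by metis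
    interpret F: walk_from_zero a \<Omega> "\<lambda>d. v' (int d)"
      using closed_walk_from_zero C1 v' by blast
    interpret B: walk_from_zero a \<Omega> "\<lambda>d. v' (- int d)"
      using closed_walk_from_zero[OF C1 closed_walk_reverse[OF v'(1)]] v' by simp
    have ne: "v' 1 None \<noteq> v' (- 1) None"
      using v'(1)[unfolded closed_walk_def, rule_format, of "- 1"] by auto
    \<comment> \<open>Otherwise the word with the prefix of \<open>\<beta>\<close> of length \<open>s - 2\<close> has height \<open>s - 1\<close>: it is still
      zero at distance \<open>s - 1\<close> and decides about the first colour at distance \<open>s + 1\<close>.\<close>
    have "s = length \<beta> + 3"
    proof (rule ccontr)
      assume "s \<noteq> length \<beta> + 3"
      then have len: "length (take (s - 2) \<beta>) = s - 2" using short by simp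
      let ?w = "replicate m (\<not> a) @ take (s - 2) \<beta>"
      have mem': "?w \<in> \<Omega>"
        using mem F.prefix_mem[of ?w "drop (s - 2) \<beta>"] by simp
      have alt: "successively (\<noteq>) ((\<not> a) # take (s - 2) \<beta>)"
        using \<beta> successively_append_iff[of "(\<noteq>)" "(\<not> a) # take (s - 2) \<beta>" "drop (s - 2) \<beta>"] by simp
      have h: "F.height ?w = s - 1"
        using alternations_alternating[OF alt] m len s
        by (simp add: alternations_append alternations_replicate)
      have ends: "v' (int (s + 1)) = v' (- int (s - 1))" "v' (int (s - 1)) = v' (- int (s + 1))"
        by (rule closed_walk_ends[OF v'(1)], use s in simp)+
      have top: "length (take (s - 2) \<beta>) + 3 = s + 1" using len s by linarith
      have "v' (int (s - 1)) (Some ?w) = 0" "v' (- int (s - 1)) (Some ?w) = 0"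
        using F.vanish_low[OF mem'] B.vanish_low[OF mem'] unfolding h by blast+
      then have "v' (int (s + 1)) (Some ?w) = 0" "v' (- int (s + 1)) (Some ?w) = 0"
        using ends by metis+
      then have "v' 1 None = 0" and "v' (- 1) None = 0"
        using F.second_value_iff[OF mem' m alt] B.second_value_iff[OF mem' m alt]
        unfolding top by simp_all
      then show False using ne by simp
    qed
    then have top: "length \<beta> + 3 = s" by simp
    have "v' 1 None = 0 \<longleftrightarrow> v' (- 1) None = 0"
      using F.second_value_iff[OF mem m \<beta>] B.second_value_iff[OF mem m \<beta>]
      unfolding top closed_walk_ends[OF v'(1), of s s, OF mult_2[symmetric]] by simp
    moreover have "v' 1 None = v 1 None" "v' (- 1) None = v (- 1) None"
      by (rule v'(2), simp)+
    ultimately show ?thesis using ne top by metis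
  qed
  have odd_nz: "v d None \<noteq> 0" if "odd d" for d
  proof -
    obtain e where d: "d = 1 + 2 * e"
      using \<open>odd d\<close> oddE by (metis add.commute)
    show ?thesis
      using both[OF closed_walk_rotate[OF walk, of e]] unfolding d by blast
  qed
  have s: "s = length \<beta> + 3" using both[OF walk] by blast
  obtain v' where v': "closed_walk a \<Omega> s v'" "\<And>d. odd d \<Longrightarrow> v' d None = v d None"
      "v' 0 None = 0" "\<And>w. w \<in> \<Omega> \<Longrightarrow> v' 0 (Some w) = 0"
    using closed_walk_normalise[OF fin C1 cl walk] by metis
  interpret F: walk_from_zero a \<Omega> "\<lambda>d. v' (int d)"
    using closed_walk_from_zero C1 v' by blast
  interpret B: walk_from_zero a \<Omega> "\<lambda>d. v' (- int d)"
    using closed_walk_from_zero[OF C1 closed_walk_reverse[OF v'(1)]] v' by simp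
  have height: "F.height w + 2 = s + 1" "F.height w = s - 1"
    using w(3) s by simp_all
  have odd_nz': "v' (int d) None \<noteq> 0" if "odd d" for d
  proof -
    have "odd (int d)" using that by simp
    then show ?thesis using odd_nz v'(2) by metis
  qed
  have "v' (int (s + 1)) (Some w) \<noteq> 0"
    using F.values_nonzero[OF odd_nz' w(1,2)] unfolding height(1) by blast
  moreover have "v' (- int (s - 1)) (Some w) = 0"
    using B.vanish_low[OF w(1)] unfolding height(2) by blast
  moreover have "v' (int (s + 1)) = v' (- int (s - 1))"
    by (rule closed_walk_ends[OF v'(1)]) (use s in simp)
  ultimately show False by simp
qed

section \<open>From cycles of the graph to closed walks\<close>

lemma cas_with_proj:
  assumes "pre_digraph.cas (with_proj G) u p v"
  shows "pre_digraph.awalk_verts (with_proj G) u p = u # map snd p"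
    and "p \<noteq> [] \<Longrightarrow> fst (hd p) = u \<and> snd (last p) = v"
    and "Suc i < length p \<Longrightarrow> snd (p ! i) = fst (p ! Suc i)"
proof -
  show "pre_digraph.awalk_verts (with_proj G) u p = u # map snd p"
    using assms
    by (induction p arbitrary: u)
      (auto simp del: cas_with_proj_eq awalk_verts_with_proj_eq
        simp: pre_digraph.cas.simps pre_digraph.awalk_verts.simps)
  show "fst (hd p) = u \<and> snd (last p) = v" if "p \<noteq> []"
    using assms that
    by (induction p arbitrary: u)
      (auto simp del: cas_with_proj_eq simp: pre_digraph.cas.simps)
  show "snd (p ! i) = fst (p ! Suc i)" if "Suc i < length p"
    using assms that
  proof (induction p arbitrary: u i)
    case (Cons x p)
    then have *: "pre_digraph.cas (with_proj G) (snd x) p v"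
      by (simp del: cas_with_proj_eq add: pre_digraph.cas.simps)
    show ?case
    proof (cases i)
      case 0
      then show ?thesis using * Cons.prems(2)
        by (cases p) (simp_all del: cas_with_proj_eq add: pre_digraph.cas.simps)
    next
      case (Suc j)
      then show ?thesis using Cons.IH[OF *, of j] Cons.prems(2) by simp
    qed
  qed simp
qed

text \<open>Vertices are read off as heads of arcs: \<^const>\<open>pre_digraph.cycle\<close> requires distinctness of all
  vertices but the first, and these are the heads.\<close>

lemma cycle_vertices:
  assumes "pre_digraph.cycle (with_proj G) p"
  obtains W :: "int \<Rightarrow> 'v" where "\<And>i. (W i, W (i + 1)) \<in> parcs G"
    "\<And>i j. W i = W j \<longleftrightarrow> i mod int (length p) = j mod int (length p)"
proof -
  let ?k = "length p"
  obtain u where aw: "pre_digraph.awalk (with_proj G) u p u"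
    and dist: "distinct (tl (pre_digraph.awalk_verts (with_proj G) u p))" and ne: "p \<noteq> []"
    using assms unfolding pre_digraph.cycle_def by blast
  have cas: "pre_digraph.cas (with_proj G) u p u" and arcs: "set p \<subseteq> parcs G"
    using aw unfolding pre_digraph.awalk_def by (simp_all del: cas_with_proj_eq)
  have dist: "distinct (map snd p)" using dist unfolding cas_with_proj(1)[OF cas] by simp
  define W where "W i = snd (p ! nat (i mod int ?k))" for i
  have k: "?k > 0" using ne by simp
  have lt: "nat (i mod int ?k) < ?k" for i
    using k pos_mod_bound[of "int ?k" i] by (simp add: nat_less_iff)
  have "(W i, W (i + 1)) \<in> parcs G" for i
  proof -
    let ?j = "nat (i mod int ?k)"
    have "W i = fst (p ! nat ((i + 1) mod int ?k))"
    proof (cases "Suc ?j < ?k")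
      case True
      have "(i + 1) mod int ?k = (i mod int ?k + 1) mod int ?k"
        by (simp add: mod_add_left_eq)
      also have "\<dots> = i mod int ?k + 1"
        using True k by (intro mod_pos_pos_trivial) auto
      finally have "nat ((i + 1) mod int ?k) = Suc ?j"
        using k by (simp add: nat_add_distrib)
      then show ?thesis using cas_with_proj(3)[OF cas True] by (simp add: W_def)
    next
      case False
      then have j: "Suc ?j = ?k" using lt[of i] by simp
      moreover have "int (nat (i mod int ?k)) = i mod int ?k"
        using k by simp
      ultimately have "i mod int ?k + 1 = int ?k" by linarith
      then have "(i + 1) mod int ?k = 0"
        by (metis mod_add_left_eq mod_self)
      moreover have "nat (i mod int ?k) = ?k - 1" using j by linarith
      ultimately show ?thesis
        using cas_with_proj(2)[OF cas ne] ne
        by (simp add: W_def hd_conv_nth last_conv_nth)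
    qed
    then have "(W i, W (i + 1)) = p ! nat ((i + 1) mod int ?k)"
      by (simp add: W_def)
    moreover have "p ! nat ((i + 1) mod int ?k) \<in> set p"
      using lt nth_mem by blast
    ultimately show ?thesis using arcs by auto
  qed
  moreover have "W i = W j \<longleftrightarrow> i mod int ?k = j mod int ?k" for i j
  proof -
    have "W i = W j \<longleftrightarrow> nat (i mod int ?k) = nat (j mod int ?k)"
      using nth_eq_iff_index_eq[OF dist] lt by (simp add: W_def)
    then show ?thesis using k by (simp add: eq_nat_nat_iff)
  qed
  ultimately show ?thesis using that by blast
qed

definition untag :: "'x + 'x \<Rightarrow> 'x" where
  "untag x = (case x of Inl l \<Rightarrow> l | Inr r \<Rightarrow> r)"

lemma untag_eq_iff: "isl x = isl y \<Longrightarrow> untag x = untag y \<longleftrightarrow> x = y"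
  by (cases x; cases y) (simp_all add: untag_def)

lemma Gamma_arc:
  assumes "(x, y) \<in> parcs (Gamma \<Omega> TYPE('f::field))"
  shows "linked (isl x) \<Omega> (untag x) (untag y)" "isl y \<longleftrightarrow> \<not> isl x" "untag x \<in> coord_space \<Omega>"
proof -
  have "linked False \<Omega> r l" if "linked True \<Omega> l r" for l r :: "'f coords"
    using that linked_swap[of False \<Omega> r l] by simp
  with assms show "linked (isl x) \<Omega> (untag x) (untag y)" "isl y \<longleftrightarrow> \<not> isl x"
      "untag x \<in> coord_space \<Omega>"
    by (auto simp: Gamma_def Let_def untag_def incident_eq_linked)
qed

text \<open>Sides alternate, so the length is even, and the origin can be placed on the side that \<open>a\<close>
  names. At distance two the vertices of a cycle of length at least three differ; being neighbours
  of one vertex, they differ in colour.\<close>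

lemma cycle_closed_walk:
  fixes p :: "(('f::field coords + 'f coords) \<times> ('f coords + 'f coords)) list"
  assumes C1: "C1 \<Omega>" and cyc: "pre_digraph.cycle (with_proj (Gamma \<Omega> TYPE('f))) p"
    and len: "length p \<ge> 3"
  obtains s and v :: "int \<Rightarrow> 'f coords" where "length p = 2 * s" "closed_walk a \<Omega> s v"
proof -
  obtain W :: "int \<Rightarrow> 'f coords + 'f coords" where
    arc: "\<And>i. (W i, W (i + 1)) \<in> parcs (Gamma \<Omega> TYPE('f))" and
    eq: "\<And>i j. W i = W j \<longleftrightarrow> i mod int (length p) = j mod int (length p)"
    using cycle_vertices[OF cyc] by metis
  have alt: "isl (W (i + 1)) \<longleftrightarrow> \<not> isl (W i)" for i
    using Gamma_arc(2)[OF arc] .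
  have parity: "isl (W (i + d)) \<longleftrightarrow> (isl (W i) \<longleftrightarrow> even d)" for i d
  proof (induction d rule: int_induct[where k = 0])
    case base
    show ?case by simp
  next
    case (step1 d)
    then show ?case using alt[of "i + d"] by (auto simp: add.assoc)
  next
    case (step2 d)
    then show ?case using alt[of "i + d - 1"] by (auto simp: algebra_simps)
  qed
  have "W (0 + int (length p)) = W 0" unfolding eq by simp
  then have "even (int (length p))" using parity[of 0 "int (length p)"] by auto
  then obtain s where s: "length p = 2 * s" by auto
  have "isl (W 0) = a \<or> isl (W 1) = a" using alt[of 0] by auto
  then obtain e where e: "isl (W e) = a" by blast
  define v where "v d = untag (W (e + d))" for d
  have side: "isl (W (e + d)) = side_bit a d" for d
    using parity[of e d] e by (auto simp: side_bit_def)
  have link: "linked (side_bit a d) \<Omega> (v d) (v (d + 1))" for d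
    using Gamma_arc(1)[OF arc[of "e + d"]] unfolding side v_def by (simp add: add.assoc)
  have coord: "v d \<in> coord_space \<Omega>" for d
    using Gamma_arc(3)[OF arc[of "e + d"]] unfolding v_def .
  have "closed_walk a \<Omega> s v"
    unfolding closed_walk_def
  proof (intro allI conjI)
    fix d :: int
    show "linked (side_bit a d) \<Omega> (v d) (v (d + 1))" using link .
    have "(e + (d + 2 * int s)) mod int (length p) = (e + d) mod int (length p)"
      using s by (metis add.assoc mod_add_self2 of_nat_mult of_nat_numeral)
    then show "v (d + 2 * int s) = v d" unfolding v_def using eq by metis
    show "v d None \<noteq> v (d + 2) None"
    proof
      assume same: "v d None = v (d + 2) None"
      have flip: "side_bit a (d + 1) = (\<not> side_bit a d)"
        by (simp add: side_bit_def)
      have l: "linked (side_bit a (d + 1)) \<Omega> (v (d + 1)) (v d)"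
        unfolding flip using link[of d] linked_swap by blast
      have r: "linked (side_bit a (d + 1)) \<Omega> (v (d + 1)) (v (d + 2))"
        using link[of "d + 1"] by (simp add: add.assoc)
      have "v d = v (d + 2)"
      proof (rule PiE_ext)
        show "v d \<in> insert None (Some ` \<Omega>) \<rightarrow>\<^sub>E UNIV" "v (d + 2) \<in> insert None (Some ` \<Omega>) \<rightarrow>\<^sub>E UNIV"
          using coord unfolding coord_space_def by blast+
        show "v d i = v (d + 2) i" if "i \<in> insert None (Some ` \<Omega>)" for i
          using that same linked_determines[OF C1 l r same] by blast
      qed
      then have "W (e + d) = W (e + (d + 2))"
        using untag_eq_iff side unfolding v_def by (metis dvd_add_triv_right_iff side_bit_def)
      then have "(e + (d + 2)) mod int (length p) = (e + d) mod int (length p)"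
        using eq by metis
      then have "int (length p) dvd (e + (d + 2)) - (e + d)"
        by (simp only: mod_eq_dvd_iff)
      then have "int (length p) dvd 2" by simp
      then show False using len zdvd_imp_le[of "int (length p)" 2] by simp
    qed
  qed
  with s that show ?thesis by blast
qed

theorem theorem10:
  fixes \<Omega> :: "bits set" and a :: bool and t m :: nat and n :: "nat \<Rightarrow> nat"
    and \<gamma> \<beta> :: bits
  assumes "finite \<Omega>" and "C1 \<Omega>"
    and "S_set \<Omega> \<union> H_set a \<Omega> \<subseteq> \<Omega>"
    and "t > 0" and "\<forall>i\<in>{1..t}. n i > 0" and "m > 0"
    and "\<gamma> \<in> M_set a \<union> {[]}" and "\<beta> \<in> M_set a \<union> {[]}"
    and "length \<beta> = length \<gamma> + 2 * t - 1"
    and "{concat (map (\<lambda>i. a # replicate (n i) (\<not> a)) [1..<t+1]) @ \<gamma>,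
          replicate m (\<not> a) @ \<beta>} \<subseteq> \<Omega>"
  shows "girth (Gamma \<Omega> TYPE('f::{field,finite})) \<ge> enat (2 * (length \<beta> + 4))"
  unfolding girth_def
proof (rule INF_greatest, clarify)
  fix p assume cyc: "pre_digraph.cycle (with_proj (Gamma \<Omega> TYPE('f))) p" and len: "3 \<le> length p"
  let ?w = "concat (map (\<lambda>i. a # replicate (n i) (\<not> a)) [1..<t+1]) @ \<gamma>"
  have pos: "\<forall>i\<in>set [1..<t+1]. n i > 0"
    using assms(5) by (simp add: atLeastLessThanSuc_atLeastAtMost del: upt_Suc)
  note alt = M_set_alternating[OF assms(7)] M_set_alternating[OF assms(8)]
  have "alternations (\<not> a) ?w = length \<beta> + 1"
    using alternations_blocks[OF pos, of a \<gamma>] alternations_alternating[OF alt(1)] assms(4,9) by simp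
  moreover obtain s and v :: "int \<Rightarrow> 'f coords" where s: "length p = 2 * s" and v: "closed_walk a \<Omega> s v"
    using cycle_closed_walk[OF assms(2) cyc len] by metis
  ultimately have "s \<ge> length \<beta> + 4"
    using closed_walk_long[OF assms(1-3) v _ assms(6) alt(2) _ _ blocks_no_double[OF pos alt(1)]] assms(10) len
    by simp
  then show "enat (2 * (length \<beta> + 4)) \<le> enat (length p)" using s by simp
qed

end
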